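(* Let $H$ be a sparse semigroup of genus $g\ge 5$ with Frobenius number $\ell_g=2g-5$. Then $H$ is one of the following: (1) $H=3\mathbb{N}+H_{11}$, and $H$ is $4$-hyperelliptic; (2) $H=3\mathbb{N}+H_{13}$, and $H$ is $4$-hyperelliptic; (3) $H=2(\mathbb{N}\setminus\{1,3\})\cup H_{2g-4}$, with $g\ge 6$, and $H$ is $2$-hyperelliptic; (4) $H=\{0,5,7\}\cup H_9$, and $H$ is $4$-hyperelliptic; (5) $H=\{0,5,7,10\}\cup H_{11}$, and $H$ is $4$-hyperelliptic; (6) $H=\{0,5,7,10,12\}\cup H_{13}$, and $H$ is $4$-hyperelliptic; (7) $H=\{0,5\}\cup H_7$, and $H$ is $3$-hyperelliptic; (8) $H=\{0,5,8\}\cup H_9$, and $H$ is $3$-hyperelliptic; (9) $H=\{0,5,8,10\}\cup H_{11}$, and $H$ is $3$-hyperelliptic; (10) $H=2(\mathbb{N}\setminus\{1,2\})\cup H_{2g-4}$, with $g\ge 5$, and $H$ is $2$-hyperelliptic.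
   Context: $\mathbb{N}$ is the set of natural numbers including $0$. A numerical semigroup $H\subseteq\mathbb{N}$ of genus $g\ge 1$ is a subset containing $0$, closed under addition, whose complement $\mathbb{N}\setminus H=\{1=\ell_1<\ell_2<\dots<\ell_g\}$ has exactly $g$ elements, called gaps; $\ell_g$ is the Frobenius number. $H$ is sparse if $\ell_i-\ell_{i-1}\le 2$ for all $i=2,\dots,g$. A numerical semigroup is $\gamma$-hyperelliptic if it has exactly $\gamma$ even gaps. For $n\in\mathbb{N}$, $H_n:=\{0,n+1,n+2,\dots\}$; $m\mathbb{N}+H_n:=\{ma+h: a\in\mathbb{N},\,h\in H_n\}$; for $A\subseteq\mathbb{N}$, $2A:=\{2a:a\in A\}$. *)

theory Defs
  imports Main
begin

definition numerical_semigroup :: "nat set \<Rightarrow> bool" where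
  "numerical_semigroup H \<longleftrightarrow>
     0 \<in> H \<and> (\<forall>a\<in>H. \<forall>b\<in>H. a + b \<in> H) \<and> finite (- H)"

definition gaps :: "nat set \<Rightarrow> nat set" where
  "gaps H = - H"

definition genus :: "nat set \<Rightarrow> nat" where
  "genus H = card (gaps H)"

(* The i-th smallest gap, counted from 1; meaningful only for 1 \<le> i \<le> genus H. *)
definition gap :: "nat set \<Rightarrow> nat \<Rightarrow> nat" where
  "gap H i = sorted_list_of_set (gaps H) ! (i - 1)"

(* Meaningful only if genus H \<ge> 1. *)
definition frobenius_number :: "nat set \<Rightarrow> nat" where
  "frobenius_number H = gap H (genus H)"

(* The truncated subtraction is exact here, since the gaps are listed in increasing order. *)
definition sparse_semigroup :: "nat set \<Rightarrow> bool" where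
  "sparse_semigroup H \<longleftrightarrow>
     numerical_semigroup H \<and> (\<forall>i\<in>{2..genus H}. gap H i - gap H (i - 1) \<le> 2)"

definition hyperelliptic :: "nat \<Rightarrow> nat set \<Rightarrow> bool" where
  "hyperelliptic \<gamma> H \<longleftrightarrow>
     numerical_semigroup H \<and> card {l \<in> gaps H. even l} = \<gamma>"

definition ordinary :: "nat \<Rightarrow> nat set" where
  "ordinary n = {0} \<union> {n<..}"

definition multiples_plus :: "nat \<Rightarrow> nat set \<Rightarrow> nat set" where
  "multiples_plus m A = {m * a + h | a h. h \<in> A}"

definition double :: "nat set \<Rightarrow> nat set" where
  "double A = {2 * a | a. a \<in> A}"

end

theory Submission
  imports Defs
begin

text \<open>Call \<open>l\<close> a single leap if \<open>l\<close> and \<open>l + 1\<close> are both gaps. In a sparse semigroup every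
  positive nongap below the Frobenius number \<open>F\<close> is isolated, so that the gaps other than \<open>F\<close> are
  either single leaps or predecessors of such a nongap. Counting gives \<open>2g - 1 - F\<close> single leaps,
  hence four of them if \<open>F = 2g - 5\<close>. As \<open>1, \<dots>, m - 2\<close> are single leaps for the multiplicity \<open>m\<close>,
  this forces \<open>m \<le> 6\<close>, and for each \<open>m\<close> the position of the remaining single leaps determines \<open>H\<close>.\<close>

section \<open>Numerical semigroups and the Frobenius number as largest gap\<close>

lemma numerical_semigroup_add:
  "numerical_semigroup H \<Longrightarrow> a \<in> H \<Longrightarrow> b \<in> H \<Longrightarrow> a + b \<in> H"
  by (simp add: numerical_semigroup_def)

lemma numerical_semigroup_mult:
  assumes "numerical_semigroup H" "m \<in> H"
  shows "m * k \<in> H"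
  using assms by (induction k) (auto simp: numerical_semigroup_def)

lemma one_notin_numerical_semigroup:
  assumes "numerical_semigroup H" "genus H \<ge> 1"
  shows "1 \<notin> H"
proof
  assume "1 \<in> H"
  then have "k \<in> H" for k
    using numerical_semigroup_mult[OF assms(1), of 1 k] by simp
  then have "- H = {}" by blast
  with assms(2) show False by (simp add: genus_def gaps_def)
qed

text \<open>Trades the positional definition for a maximum, from which it follows that the Frobenius
  number is a gap and that everything above it lies in \<open>H\<close>.\<close>

lemma frobenius_number_eq_Max:
  assumes "numerical_semigroup H" "genus H \<ge> 1"
  shows "frobenius_number H = Max (- H)"
proof -
  have fin: "finite (- H)" using assms(1) by (simp add: numerical_semigroup_def)
  have ne: "- H \<noteq> {}" using assms(2) by (auto simp: genus_def gaps_def)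
  define xs where "xs = sorted_list_of_set (- H)"
  have xs: "sorted xs" "set xs = - H" and len: "length xs = card (- H)"
    using fin by (simp_all add: xs_def)
  have F: "frobenius_number H = xs ! (length xs - 1)"
    by (simp add: frobenius_number_def gap_def genus_def gaps_def xs_def)
  have pos: "0 < length xs" using fin ne len by (simp add: card_gt_0_iff)
  show ?thesis unfolding F
  proof (rule Max_eqI[symmetric, OF fin])
    show "xs ! (length xs - 1) \<in> - H" using pos nth_mem xs(2) by (metis diff_less zero_less_one)
    fix y assume "y \<in> - H"
    then obtain i where "i < length xs" "y = xs ! i" using xs(2) by (metis in_set_conv_nth)
    then show "y \<le> xs ! (length xs - 1)" using xs(1) by (simp add: sorted_nth_mono)
  qed
qed

lemma frobenius_number_notin:
  assumes "numerical_semigroup H" "genus H \<ge> 1"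
  shows "frobenius_number H \<notin> H"
proof -
  have "finite (- H)" using assms(1) by (simp add: numerical_semigroup_def)
  moreover have "- H \<noteq> {}" using assms(2) by (auto simp: genus_def gaps_def)
  ultimately have "Max (- H) \<in> - H" by (rule Max_in)
  then show ?thesis using frobenius_number_eq_Max[OF assms] by simp
qed

lemma frobenius_number_less_imp_mem:
  assumes "numerical_semigroup H" "genus H \<ge> 1" "frobenius_number H < n"
  shows "n \<in> H"
proof (rule ccontr)
  assume "n \<notin> H"
  then have "n \<le> Max (- H)" using assms(1) by (simp add: numerical_semigroup_def)
  then show False using assms(3) frobenius_number_eq_Max[OF assms(1,2)] by simp
qed

section \<open>Isolated nongaps and the number of single leaps\<close>

lemma sparse_semigroup_isolated:
  assumes "sparse_semigroup H" "genus H \<ge> 1"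
    and "n \<in> H" "0 < n" "Suc n < frobenius_number H"
  shows "Suc n \<notin> H"
proof
  assume Suc_n: "Suc n \<in> H"
  have H: "numerical_semigroup H" using assms(1) by (simp add: sparse_semigroup_def)
  have fin: "finite (- H)" using H by (simp add: numerical_semigroup_def)
  define xs where "xs = sorted_list_of_set (- H)"
  have set_xs: "set xs = - H" and len: "length xs = genus H"
    using fin by (simp_all add: xs_def genus_def gaps_def)
  have leap: "xs ! Suc i - xs ! i \<le> 2" if "Suc i < length xs" for i
  proof -
    \<comment> \<open>\<open>gap\<close> counts from 1 and \<open>xs\<close> from 0, so the
      positions \<open>i\<close> and \<open>Suc i\<close> of \<open>xs\<close> hold the gaps
      numbered \<open>i + 1\<close> and \<open>i + 2\<close>.\<close>
    have "Suc (Suc i) \<in> {2..genus H}" using that len by auto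
    then have "gap H (Suc (Suc i)) - gap H (Suc (Suc i) - 1) \<le> 2"
      using assms(1) unfolding sparse_semigroup_def by blast
    then show ?thesis by (simp add: gap_def gaps_def xs_def)
  qed
  \<comment> \<open>\<open>Max I\<close> is the position of the last gap below \<open>n\<close>,
    which exists because 1 is a gap below \<open>n\<close>. A next gap exists because
    \<open>n\<close> is below the Frobenius number. If \<open>n\<close> and \<open>Suc n\<close>
    were both nongaps, the leap between these two gaps would be at least 3.\<close>
  define I where "I = {i. i < length xs \<and> xs ! i < n}"
  have "1 \<noteq> n" using assms one_notin_numerical_semigroup[OF H] by blast
  moreover obtain j where "j < length xs" "xs ! j = 1"
    using one_notin_numerical_semigroup[OF H assms(2)] set_xs by (metis ComplI in_set_conv_nth)
  ultimately have "j \<in> I" using assms(4) by (simp add: I_def)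
  then have "I \<noteq> {}" by blast
  moreover have finI: "finite I" by (simp add: I_def)
  ultimately have "Max I \<in> I" by (rule Max_in[rotated])
  then have i: "Max I < length xs" "xs ! Max I < n" by (simp_all add: I_def)
  have last: "xs ! (length xs - 1) = frobenius_number H"
    by (simp add: frobenius_number_def gap_def gaps_def genus_def xs_def)
  have Suc_i: "Suc (Max I) < length xs"
  proof (rule ccontr)
    assume "\<not> ?thesis"
    then have "Max I = length xs - 1" using i(1) by simp
    then show False using i(2) last assms(5) by simp
  qed
  have "Suc (Max I) \<notin> I" using Max_ge[OF finI, of "Suc (Max I)"] by auto
  then have "n \<le> xs ! Suc (Max I)" using Suc_i by (simp add: I_def)
  moreover have "xs ! Suc (Max I) \<notin> H" using Suc_i set_xs nth_mem by blast
  ultimately have "Suc (Suc n) \<le> xs ! Suc (Max I)"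
    using assms(3) Suc_n by (metis Suc_leI le_neq_implies_less)
  then show False using leap[OF Suc_i] i(2) by simp
qed

definition single_leaps :: "nat set \<Rightarrow> nat set" where
  "single_leaps H = {l. l \<notin> H \<and> Suc l \<notin> H}"

text \<open>Let \<open>s\<close> and \<open>p\<close> be the numbers of single leaps and of elements
  of \<open>P\<close>, and let \<open>F\<close> be the Frobenius number. Splitting the gaps gives
  \<open>genus H = 1 + s + p\<close>. By isolation, successor is a bijection from \<open>P\<close>
  onto the positive nongaps below \<open>F\<close>, so splitting \<open>{1..F}\<close> gives
  \<open>F = p + genus H\<close>. Eliminating \<open>p\<close> yields the formula.\<close>

lemma card_single_leaps:
  assumes "sparse_semigroup H" "genus H \<ge> 1"
  shows "card (single_leaps H) + frobenius_number H + 1 = 2 * genus H"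
proof -
  let ?F = "frobenius_number H"
  have H: "numerical_semigroup H" using assms(1) by (simp add: sparse_semigroup_def)
  note F = frobenius_number_notin[OF H assms(2)] frobenius_number_less_imp_mem[OF H assms(2)]
  have fin: "finite (- H)" and zero: "0 \<in> H" using H by (simp_all add: numerical_semigroup_def)
  define N where "N = H \<inter> {1..?F}"
  define P where "P = {l. l \<notin> H \<and> l \<noteq> ?F \<and> Suc l \<in> H}"
  have le: "l \<le> ?F" if "l \<notin> H" for l using F(2) that not_le by blast
  have split: "- H = insert ?F (single_leaps H \<union> P)"
    using F by (auto simp: single_leaps_def P_def)
  have "?F \<notin> single_leaps H" using F(2)[of "Suc ?F"] by (simp add: single_leaps_def)
  then have "card (- H) = Suc (card (single_leaps H \<union> P))"
    using fin unfolding split by (subst card_insert_disjoint) (auto simp: P_def)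
  also have "card (single_leaps H \<union> P) = card (single_leaps H) + card P"
    using fin unfolding split by (intro card_Un_disjoint) (auto simp: P_def single_leaps_def)
  finally have gaps_split: "genus H = Suc (card (single_leaps H) + card P)"
    by (simp add: genus_def gaps_def)
  have "N = Suc ` P"
  proof (intro equalityI subsetI)
    fix n assume n: "n \<in> N"
    then obtain l where l: "n = Suc l" by (cases n) (auto simp: N_def)
    have "n \<noteq> ?F" using n F(1) by (auto simp: N_def)
    then have "n < ?F" using n by (simp add: N_def)
    \<comment> \<open>Isolation speaks of positive nongaps only; \<open>l = 0\<close> would make
      \<open>n = 1\<close> a nongap.\<close>
    moreover have "l \<noteq> 0" using n l one_notin_numerical_semigroup[OF H assms(2)] by (cases l) (auto simp: N_def)
    ultimately have "l \<notin> H"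
      using sparse_semigroup_isolated[OF assms, of l] n l by (auto simp: N_def)
    then show "n \<in> Suc ` P" using n l \<open>n < ?F\<close> by (auto simp: P_def N_def)
  next
    fix n assume "n \<in> Suc ` P"
    then show "n \<in> N" using le by (force simp: P_def N_def)
  qed
  then have "card N = card P" by (simp add: card_image)
  moreover have "{1..?F} = N \<union> - H" using le zero by (auto simp: N_def Suc_le_eq intro: gr0I)
  then have "card {1..?F} = card N + card (- H)"
    using fin by (simp only:) (rule card_Un_disjoint, auto simp: N_def)
  ultimately show ?thesis using gaps_split by (simp add: genus_def gaps_def)
qed

section \<open>Membership in the sets of the classification\<close>

lemma mem_ordinary: "n \<in> ordinary k \<longleftrightarrow> n = 0 \<or> k < n"
  by (auto simp: ordinary_def)

lemma mem_multiples_plus_ordinary: "n \<in> multiples_plus m (ordinary k) \<longleftrightarrow> m dvd n \<or> k < n"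
proof
  assume "n \<in> multiples_plus m (ordinary k)"
  then show "m dvd n \<or> k < n" by (auto simp: multiples_plus_def ordinary_def)
next
  assume "m dvd n \<or> k < n"
  then show "n \<in> multiples_plus m (ordinary k)"
  proof
    assume "m dvd n"
    then obtain a where "n = m * a + 0" by auto
    then show ?thesis unfolding multiples_plus_def ordinary_def by blast
  next
    assume "k < n"
    then have "n = m * 0 + n \<and> n \<in> ordinary k" by (simp add: ordinary_def)
    then show ?thesis unfolding multiples_plus_def by blast
  qed
qed

lemma mem_double: "n \<in> double A \<longleftrightarrow> even n \<and> n div 2 \<in> A"
  by (auto simp: double_def)

text \<open>Reduces equality with a sporadic semigroup to finitely many membership tests. The
  explicit list lets the simplifier unroll them one by one.\<close>

lemma eq_Un_ordinary:
  assumes "\<And>n. k < n \<Longrightarrow> n \<in> H" "0 \<in> B"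
    and "list_all (\<lambda>n. n \<in> H \<longleftrightarrow> n \<in> B) [0..<Suc k]"
  shows "H = B \<union> ordinary k"
proof (rule set_eqI)
  fix n
  show "n \<in> H \<longleftrightarrow> n \<in> B \<union> ordinary k"
  proof (cases "k < n")
    case False
    then show ?thesis using assms(2,3) by (auto simp: list_all_iff mem_ordinary simp del: upt_Suc)
  qed (simp add: assms(1) mem_ordinary)
qed

section \<open>Sparse semigroups with four single leaps and odd Frobenius number\<close>

locale sparse_four_leaps =
  fixes H :: "nat set" and F :: nat
  assumes sparse: "sparse_semigroup H"
    and genus_pos: "genus H \<ge> 1"
    and F_def: "F = frobenius_number H"
    and odd_F: "odd F"
    and F_ge_5: "5 \<le> F"
    and card_leaps: "card (single_leaps H) = 4"
begin

lemma semigroup: "numerical_semigroup H"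
  using sparse by (simp add: sparse_semigroup_def)

lemma zero_mem: "0 \<in> H"
  using semigroup by (simp add: numerical_semigroup_def)

lemma F_notin: "F \<notin> H"
  using frobenius_number_notin[OF semigroup genus_pos] F_def by simp

lemma mem_above: "F < n \<Longrightarrow> n \<in> H"
  using frobenius_number_less_imp_mem[OF semigroup genus_pos] F_def by simp

text \<open>Since \<open>F\<close> is a gap, neither \<open>n\<close> nor \<open>Suc n\<close> can
  equal it, so \<open>sparse_semigroup_isolated\<close> leaves only positions beyond
  \<open>F\<close>. Two consecutive positive nongaps thus also serve as an upper bound for
  \<open>F\<close>.\<close>

lemma isolated:
  assumes "n \<in> H" "Suc n \<in> H" "0 < n"
  shows "F < n"
proof -
  have "\<not> Suc n < F"
    using sparse_semigroup_isolated[OF sparse genus_pos] assms F_def by blast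
  moreover have "n \<noteq> F" "Suc n \<noteq> F" using assms F_notin by auto
  ultimately show ?thesis by linarith
qed

lemma leap_less: "l \<in> single_leaps H \<Longrightarrow> l < F"
  using mem_above[of "Suc l"] by (force simp: single_leaps_def)

lemma finite_leaps: "finite (single_leaps H)"
  using card_leaps by (intro card_ge_0_finite) simp

lemma leaps_notsubset: "card B < 4 \<Longrightarrow> finite B \<Longrightarrow> \<not> single_leaps H \<subseteq> B"
  using card_mono[of B "single_leaps H"] card_leaps by auto

text \<open>Once four single leaps are exhibited there are no others, so every further gap is
  followed by a nongap.\<close>

lemma leaps_eq:
  assumes "B \<subseteq> single_leaps H" "card B = 4"
  shows "single_leaps H = B"
  using card_subset_eq[OF finite_leaps assms(1)] assms(2) card_leaps by simp

lemma card_le_leaps: "B \<subseteq> single_leaps H \<Longrightarrow> card B \<le> 4"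
  using card_mono[OF finite_leaps] card_leaps by metis

lemma one_notin: "1 \<notin> H"
  using one_notin_numerical_semigroup[OF semigroup genus_pos] .

lemma two_notin: "2 \<notin> H"
proof
  assume "2 \<in> H"
  then have even: "n \<in> H" if "even n" for n
    using numerical_semigroup_mult[OF semigroup \<open>2 \<in> H\<close>] that by (metis evenE)
  have "single_leaps H = {}"
  proof -
    have "l \<in> H \<or> Suc l \<in> H" for l using even[of l] even[of "Suc l"] by auto
    then show ?thesis by (auto simp: single_leaps_def)
  qed
  then show False using card_leaps by simp
qed

text \<open>All gaps are at most \<open>F\<close>, so for a concrete \<open>F\<close> the even gaps
  are counted by evaluating a list.\<close>

lemma hyperellipticI:
  assumes "length (filter (\<lambda>l. even l \<and> l \<notin> H) [0..<Suc F]) = \<gamma>"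
  shows "hyperelliptic \<gamma> H"
proof -
  have "n < Suc F" if "n \<notin> H" for n
    using mem_above that by (meson not_less_eq)
  then have "{l \<in> gaps H. even l} = set (filter (\<lambda>l. even l \<and> l \<notin> H) [0..<Suc F])"
    by (auto simp: gaps_def simp del: upt_Suc)
  then show ?thesis
    using assms semigroup by (simp add: hyperelliptic_def distinct_card del: set_filter upt_Suc)
qed

text \<open>Serves the two infinite families, with \<open>k = 6\<close> for multiplicity 4 and
  \<open>k = 4\<close> for multiplicity 6.\<close>

lemma hyperelliptic_2:
  assumes "\<And>n. n \<in> H \<longleftrightarrow> even n \<and> n \<notin> {2, k} \<or> F < n" "even k" "2 < k" "k < F"
  shows "hyperelliptic 2 H"
proof -
  have "{l \<in> gaps H. even l} = {2, k}" using assms(2-) by (auto simp: gaps_def assms(1))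
  then show ?thesis using semigroup assms(3) by (simp add: hyperelliptic_def)
qed

section \<open>Case analysis by the multiplicity\<close>

lemma multiplicity_3:
  assumes "3 \<in> H"
  shows "H = multiples_plus 3 (ordinary 11) \<and> hyperelliptic 4 H \<or>
         H = multiples_plus 3 (ordinary 13) \<and> hyperelliptic 4 H"
proof -
  have mult: "n \<in> H" if "3 dvd n" for n
    using numerical_semigroup_mult[OF semigroup assms] that by auto
  \<comment> \<open>Every number not divisible by 3 has a multiple of 3 next to it, so isolation
    removes it from \<open>H\<close> up to \<open>F\<close>.\<close>
  have mem: "n \<in> H \<longleftrightarrow> 3 dvd n" if n: "n \<le> F" for n
  proof
    assume nH: "n \<in> H"
    show "3 dvd n"
    proof (rule ccontr)
      assume "\<not> 3 dvd n"
      have "3 dvd Suc n \<or> n \<noteq> 0 \<and> 3 dvd n - 1" using \<open>\<not> 3 dvd n\<close> by presburger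
      then consider "3 dvd Suc n" | k where "n = Suc k" "3 dvd k"
        by (metis Suc_pred' neq0_conv)
      then show False
      proof cases
        case 1
        then show ?thesis using isolated[OF nH] mult n \<open>\<not> 3 dvd n\<close> by (cases n) auto
      next
        case (2 k)
        then show ?thesis using isolated[of k] mult[of k] nH n one_notin by (cases k) auto
      qed
    qed
  qed (rule mult)
  have leap: "l \<in> single_leaps H \<longleftrightarrow> l < F \<and> l mod 3 = 1" for l
  proof
    assume l: "l \<in> single_leaps H"
    then have "\<not> 3 dvd l" "\<not> 3 dvd Suc l" using mult by (auto simp: single_leaps_def)
    then show "l < F \<and> l mod 3 = 1" using leap_less[OF l] by presburger
  next
    assume l: "l < F \<and> l mod 3 = 1"
    then have "\<not> 3 dvd l" "\<not> 3 dvd Suc l" by presburger+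
    then show "l \<in> single_leaps H" using l mem by (simp add: single_leaps_def)
  qed
  \<comment> \<open>The candidates are 1, 4, 7, 10, 13 and so on; exactly four of them lie below
    \<open>F\<close>, hence \<open>10 < F < 14\<close>.\<close>
  have "F < 14"
  proof (rule ccontr)
    assume "\<not> F < 14"
    then have "{1, 4, 7, 10, 13} \<subseteq> single_leaps H" by (auto simp: leap)
    then show False using card_le_leaps[of "{1, 4, 7, 10, 13}"] by simp
  qed
  moreover have "10 < F"
  proof (rule ccontr)
    assume F: "\<not> 10 < F"
    have "single_leaps H \<subseteq> {1, 4, 7}"
    proof
      fix l assume "l \<in> single_leaps H"
      then have "l < 10" "l mod 3 = 1" using F by (auto simp: leap)
      then show "l \<in> {1, 4, 7}" by simp presburger
    qed
    then show False using leaps_notsubset[of "{1, 4, 7}"] by simp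
  qed
  ultimately have "F = 11 \<or> F = 13" using odd_F by presburger
  moreover have H: "H = multiples_plus 3 (ordinary F)"
  proof (rule set_eqI)
    fix n
    show "n \<in> H \<longleftrightarrow> n \<in> multiples_plus 3 (ordinary F)"
      using mem[of n] mem_above[of n] by (cases "n \<le> F") (auto simp: mem_multiples_plus_ordinary)
  qed
  \<comment> \<open>In both cases the even gaps are 2, 4, 8 and 10.\<close>
  moreover have "hyperelliptic 4 H" if "F = 11 \<or> F = 13"
    using that
  proof (elim disjE)
    assume F: "F = 11"
    show ?thesis
      by (rule hyperellipticI) (simp add: H F mem_multiples_plus_ordinary upt_rec flip: One_nat_def)
  next
    assume F: "F = 13"
    show ?thesis
      by (rule hyperellipticI) (simp add: H F mem_multiples_plus_ordinary upt_rec flip: One_nat_def)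
  qed
  ultimately show ?thesis by metis
qed

text \<open>Odd numbers are adjacent to multiples of 4, so up to \<open>F\<close> they are all gaps
  by isolation. The single leaps turn out to be 1, 2, 5 and 6, and having no others puts every even
  number from 8 on into \<open>H\<close>.\<close>

lemma multiplicity_4:
  assumes "3 \<notin> H" "4 \<in> H"
  shows "H = double (UNIV - {1, 3}) \<union> ordinary (F + 1) \<and> 7 \<le> F \<and> hyperelliptic 2 H"
proof -
  have mult: "n \<in> H" if "4 dvd n" for n
    using numerical_semigroup_mult[OF semigroup assms(2)] that by auto
  have odd: "n \<notin> H" if n: "n \<le> F" "odd n" for n
  proof
    assume nH: "n \<in> H"
    have "4 dvd Suc n \<or> n \<noteq> 0 \<and> 4 dvd n - 1" using n(2) by presburger
    then consider "4 dvd Suc n" | k where "n = Suc k" "4 dvd k"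
      by (metis Suc_pred' neq0_conv)
    then show False
    proof cases
      case 1
      then show ?thesis using isolated[OF nH] mult n by (cases n) auto
    next
      case (2 k)
      then show ?thesis using isolated[of k] mult[of k] nH n one_notin by (cases k) auto
    qed
  qed
  \<comment> \<open>With 4 and 6 in \<open>H\<close>, all even numbers from 4 on are nongaps, which
    leaves at most the single leaps 1 and 2.\<close>
  have "6 \<notin> H"
  proof
    assume 6: "6 \<in> H"
    have even: "n \<in> H" if n: "even n" "4 \<le> n" for n
    proof (cases "4 dvd n")
      case False
      then have "4 dvd n - 6" "6 \<le> n" using n by presburger+
      then show ?thesis using numerical_semigroup_add[OF semigroup 6 mult[of "n - 6"]] by simp
    qed (rule mult)
    have "single_leaps H \<subseteq> {1, 2}"
    proof
      fix l assume "l \<in> single_leaps H"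
      then have "l \<notin> H" "Suc l \<notin> H" by (auto simp: single_leaps_def)
      then have "l \<noteq> 0" "\<not> (even l \<and> 4 \<le> l)" "\<not> (even (Suc l) \<and> 4 \<le> Suc l)"
        using even[of l] even[of "Suc l"] zero_mem by metis+
      then show "l \<in> {1, 2}" by simp presburger
    qed
    then show False using leaps_notsubset[of "{1, 2}"] by simp
  qed
  \<comment> \<open>For \<open>F = 5\<close> only 1 and 2 could be single leaps. The bound makes 7 a
    gap, hence 6 a single leap, and later yields \<open>g \<ge> 6\<close>.\<close>
  have F7: "7 \<le> F"
  proof (rule ccontr)
    assume "\<not> 7 \<le> F"
    then have F: "F = 5" using F_ge_5 odd_F by presburger
    have "single_leaps H \<subseteq> {1, 2}"
    proof
      fix l assume l: "l \<in> single_leaps H"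
      then have "l < 5" "l \<notin> H" "Suc l \<notin> H" using leap_less[OF l] F by (auto simp: single_leaps_def)
      moreover from this have "l = 0 \<or> l = 1 \<or> l = 2 \<or> l = 3 \<or> l = 4" by linarith
      ultimately show "l \<in> {1, 2}" using zero_mem assms by auto
    qed
    then show False using leaps_notsubset[of "{1, 2}"] by simp
  qed
  then have "{1, 2, 5, 6} \<subseteq> single_leaps H"
    using one_notin two_notin assms(1) odd[of 5] \<open>6 \<notin> H\<close> odd[of 7]
    by (auto simp: single_leaps_def numeral_2_eq_2[symmetric])
  then have leaps: "single_leaps H = {1, 2, 5, 6}" by (rule leaps_eq) simp
  have mem: "n \<in> H \<longleftrightarrow> even n \<and> n \<notin> {2, 6} \<or> F < n" for n
  proof (cases "F < n")
    case False
    show ?thesis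
    proof (cases "even n \<and> n \<notin> {2, 6}")
      case True
      \<comment> \<open>As \<open>F\<close> is odd and \<open>n\<close> is even,
        \<open>Suc n\<close> is still an odd number up to \<open>F\<close>, hence a gap. Since
        \<open>n\<close> is no single leap, it must lie in \<open>H\<close>.\<close>
      then have "Suc n \<le> F" using False odd_F by (metis Suc_leI le_neq_implies_less not_le)
      then have "Suc n \<notin> H" using odd True by simp
      moreover have "n \<notin> single_leaps H" using True leaps by auto
      ultimately show ?thesis using True by (auto simp: single_leaps_def)
    next
      case nf: False
      then show ?thesis using odd[of n] False two_notin \<open>6 \<notin> H\<close> by auto
    qed
  qed (simp add: mem_above)
  \<comment> \<open>\<open>ordinary (F + 1)\<close> has its first positive element at
    \<open>F + 2\<close>; the even number \<open>F + 1\<close>, at least 8, is supplied by the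
    doubled set.\<close>
  have "H = double (UNIV - {1, 3}) \<union> ordinary (F + 1)"
  proof (rule set_eqI)
    fix n
    show "n \<in> H \<longleftrightarrow> n \<in> double (UNIV - {1, 3}) \<union> ordinary (F + 1)"
      unfolding mem Un_iff mem_double mem_ordinary using F7 odd_F by simp presburger
  qed
  moreover have "hyperelliptic 2 H"
    by (rule hyperelliptic_2[OF mem]) (use F7 in auto)
  ultimately show ?thesis using F7 by blast
qed

text \<open>The single leaps 1, 2, 3 are given, and the case split is on whether 7 is a nongap. Sums
  of known nongaps bound \<open>F\<close>, and isolation settles the remaining memberships. The even
  gaps are 2, 4, 6, 8 if 7 lies in \<open>H\<close>, and 2, 4, 6 otherwise.\<close>

lemma multiplicity_5:
  assumes "3 \<notin> H" "4 \<notin> H" "5 \<in> H"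
  shows "(H = {0, 5, 7} \<union> ordinary 9 \<and> hyperelliptic 4 H) \<or>
         (H = {0, 5, 7, 10} \<union> ordinary 11 \<and> hyperelliptic 4 H) \<or>
         (H = {0, 5, 7, 10, 12} \<union> ordinary 13 \<and> hyperelliptic 4 H) \<or>
         (H = {0, 5} \<union> ordinary 7 \<and> hyperelliptic 3 H) \<or>
         (H = {0, 5, 8} \<union> ordinary 9 \<and> hyperelliptic 3 H) \<or>
         (H = {0, 5, 8, 10} \<union> ordinary 11 \<and> hyperelliptic 3 H)"
proof -
  have F7: "7 \<le> F"
    using F_ge_5 odd_F F_notin assms(3) by (cases "F = 5") (auto, presburger)
  note add = numerical_semigroup_add[OF semigroup]
  have 10: "10 \<in> H" and 15: "15 \<in> H" using add[OF assms(3,3)] add[OF add[OF assms(3,3)] assms(3)] by auto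
  have 6: "6 \<notin> H" using isolated[of 5] assms(3) F7 by auto
  have 9: "9 \<notin> H" if "9 \<le> F" using isolated[of 9] 10 that by auto
  have 11: "11 \<notin> H" if "11 \<le> F" using isolated[of 10] 10 that by auto
  have small: "{1, 2, 3} \<subseteq> single_leaps H"
    using one_notin two_notin assms by (auto simp: single_leaps_def numeral_eq_Suc)
  note low = zero_mem one_notin two_notin assms 6
  show ?thesis
  proof (cases "7 \<in> H")
    case 7: True
    then have F9: "9 \<le> F" using F7 F_notin odd_F by (cases "F = 7"; cases "F = 8") auto
    have 8: "8 \<notin> H" using isolated[of 7] 7 F9 by auto
    have 12: "12 \<in> H" and 14: "14 \<in> H" using add[OF assms(3) 7] add[OF 7 7] by auto
    have 13: "13 \<notin> H" if "13 \<le> F" using isolated[of 12] 12 that by auto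
    \<comment> \<open>\<open>14 = 7 + 7\<close> and \<open>15 = 5 + 5 + 5\<close> are consecutive
      nongaps.\<close>
    have "F \<le> 14" using isolated[of 14] 14 15 F_notin by (cases "F = 14") auto
    then have "F = 9 \<or> F = 11 \<or> F = 13" using F9 odd_F by presburger
    then consider "F = 9" | "F = 11" | "F = 13" by blast
    then show ?thesis
    proof cases
      case 1
      have H: "H = {0, 5, 7} \<union> ordinary 9"
        using low 7 8 9 1 mem_above by (intro eq_Un_ordinary) (simp_all add: upt_rec flip: One_nat_def)
      have "hyperelliptic 4 H"
        by (rule hyperellipticI) (simp add: H 1 mem_ordinary upt_rec flip: One_nat_def)
      with H show ?thesis by blast
    next
      case 2
      have H: "H = {0, 5, 7, 10} \<union> ordinary 11"
        using low 7 8 9 10 11 2 mem_above by (intro eq_Un_ordinary) (simp_all add: upt_rec flip: One_nat_def)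
      have "hyperelliptic 4 H"
        by (rule hyperellipticI) (simp add: H 2 mem_ordinary upt_rec flip: One_nat_def)
      with H show ?thesis by blast
    next
      case 3
      have H: "H = {0, 5, 7, 10, 12} \<union> ordinary 13"
        using low 7 8 9 10 11 12 13 3 mem_above by (intro eq_Un_ordinary) (simp_all add: upt_rec flip: One_nat_def)
      have "hyperelliptic 4 H"
        by (rule hyperellipticI) (simp add: H 3 mem_ordinary upt_rec flip: One_nat_def)
      with H show ?thesis by blast
    qed
  next
    case 7: False
    \<comment> \<open>The gaps 6 and 7 supply the fourth single leap, so 7 is not one and 8 must be
      a nongap.\<close>
    then have "{1, 2, 3, 6} \<subseteq> single_leaps H" using 6 small by (auto simp: single_leaps_def)
    then have leaps: "single_leaps H = {1, 2, 3, 6}" by (rule leaps_eq) simp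
    have 8: "8 \<in> H"
    proof -
      have "7 \<notin> single_leaps H" by (simp add: leaps)
      then show ?thesis using 7 by (simp add: single_leaps_def)
    qed
    have 13: "13 \<in> H" and 16: "16 \<in> H" using add[OF assms(3) 8] add[OF 8 8] by auto
    \<comment> \<open>\<open>15 = 5 + 5 + 5\<close> and \<open>16 = 8 + 8\<close> are consecutive
      nongaps, and \<open>13 = 5 + 8\<close> cannot be the gap \<open>F\<close>.\<close>
    have "F < 15" using isolated[of 15] 15 16 F_notin by (cases "F = 15") auto
    moreover have "F \<noteq> 13" using 13 F_notin by blast
    ultimately have "F = 7 \<or> F = 9 \<or> F = 11" using F7 odd_F by presburger
    then consider "F = 7" | "F = 9" | "F = 11" by blast
    then show ?thesis
    proof cases
      case 1
      have H: "H = {0, 5} \<union> ordinary 7"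
        using low 7 1 mem_above by (intro eq_Un_ordinary) (simp_all add: upt_rec flip: One_nat_def)
      have "hyperelliptic 3 H"
        by (rule hyperellipticI) (simp add: H 1 mem_ordinary upt_rec flip: One_nat_def)
      with H show ?thesis by blast
    next
      case 2
      have H: "H = {0, 5, 8} \<union> ordinary 9"
        using low 7 8 9 2 mem_above by (intro eq_Un_ordinary) (simp_all add: upt_rec flip: One_nat_def)
      have "hyperelliptic 3 H"
        by (rule hyperellipticI) (simp add: H 2 mem_ordinary upt_rec flip: One_nat_def)
      with H show ?thesis by blast
    next
      case 3
      have H: "H = {0, 5, 8, 10} \<union> ordinary 11"
        using low 7 8 9 10 11 3 mem_above by (intro eq_Un_ordinary) (simp_all add: upt_rec flip: One_nat_def)
      have "hyperelliptic 3 H"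
        by (rule hyperellipticI) (simp add: H 3 mem_ordinary upt_rec flip: One_nat_def)
      with H show ?thesis by blast
    qed
  qed
qed

text \<open>The gaps 1 to 5 already use up the four single leaps. From 5 up to \<open>F\<close>, two
  neighbours are then never both gaps, and by isolation never both nongaps, so membership
  alternates, starting from the gap 5.\<close>

lemma multiplicity_ge_6:
  assumes "3 \<notin> H" "4 \<notin> H" "5 \<notin> H"
  shows "H = double (UNIV - {1, 2}) \<union> ordinary (F + 1) \<and> hyperelliptic 2 H"
proof -
  have "{1, 2, 3, 4} \<subseteq> single_leaps H"
    using one_notin two_notin assms by (auto simp: single_leaps_def numeral_eq_Suc)
  then have leaps: "single_leaps H = {1, 2, 3, 4}" by (rule leaps_eq) simp
  have alternate: "5 + k \<in> H \<longleftrightarrow> odd k" if "5 + k \<le> F" for k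
    using that
  proof (induction k)
    case 0
    then show ?case using assms by simp
  next
    case (Suc k)
    have "5 + k \<notin> single_leaps H" by (simp add: leaps)
    then have "5 + k \<in> H \<or> 5 + Suc k \<in> H" by (simp add: single_leaps_def)
    moreover have "\<not> (5 + k \<in> H \<and> 5 + Suc k \<in> H)"
      using isolated[of "5 + k"] Suc.prems by auto
    ultimately show ?case using Suc by auto
  qed
  have upper: "n \<in> H \<longleftrightarrow> even n" if "5 \<le> n" "n \<le> F" for n
  proof -
    have "odd (n - 5) \<longleftrightarrow> even n" using that(1) by presburger
    then show ?thesis using alternate[of "n - 5"] that by simp
  qed
  have mem: "n \<in> H \<longleftrightarrow> even n \<and> n \<notin> {2, 4} \<or> F < n" for n
  proof -
    consider "n = 0" | "n = 1" | "n = 2" | "n = 3" | "n = 4" | "5 \<le> n" by linarith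
    then show ?thesis
      by cases (use zero_mem one_notin two_notin assms upper[of n] mem_above[of n] F_ge_5 le_less_linear[of n F] in auto)
  qed
  \<comment> \<open>Here too \<open>F + 1\<close> comes from the doubled set: it is even and at
    least 6.\<close>
  have "H = double (UNIV - {1, 2}) \<union> ordinary (F + 1)"
  proof (rule set_eqI)
    fix n
    show "n \<in> H \<longleftrightarrow> n \<in> double (UNIV - {1, 2}) \<union> ordinary (F + 1)"
      unfolding mem Un_iff mem_double mem_ordinary using F_ge_5 odd_F by simp presburger
  qed
  moreover have "hyperelliptic 2 H"
    by (rule hyperelliptic_2[OF mem]) (use F_ge_5 in auto)
  ultimately show ?thesis by blast
qed

end

section \<open>Classification for Frobenius number \<open>2 * g - 5\<close>\<close>

theorem theorem2p9:
  fixes H :: "nat set" and g :: nat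
  assumes "sparse_semigroup H"
    and "genus H = g"
    and "g \<ge> 5"
    and "frobenius_number H = 2 * g - 5"
  shows "(H = multiples_plus 3 (ordinary 11) \<and> hyperelliptic 4 H) \<or>
         (H = multiples_plus 3 (ordinary 13) \<and> hyperelliptic 4 H) \<or>
         (H = double (UNIV - {1, 3}) \<union> ordinary (2 * g - 4) \<and> g \<ge> 6 \<and> hyperelliptic 2 H) \<or>
         (H = {0, 5, 7} \<union> ordinary 9 \<and> hyperelliptic 4 H) \<or>
         (H = {0, 5, 7, 10} \<union> ordinary 11 \<and> hyperelliptic 4 H) \<or>
         (H = {0, 5, 7, 10, 12} \<union> ordinary 13 \<and> hyperelliptic 4 H) \<or>
         (H = {0, 5} \<union> ordinary 7 \<and> hyperelliptic 3 H) \<or>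
         (H = {0, 5, 8} \<union> ordinary 9 \<and> hyperelliptic 3 H) \<or>
         (H = {0, 5, 8, 10} \<union> ordinary 11 \<and> hyperelliptic 3 H) \<or>
         (H = double (UNIV - {1, 2}) \<union> ordinary (2 * g - 4) \<and> g \<ge> 5 \<and> hyperelliptic 2 H)"
proof -
  have "card (single_leaps H) + frobenius_number H + 1 = 2 * genus H"
    using assms by (intro card_single_leaps) simp_all
  \<comment> \<open>The truncated subtraction in \<open>2 * g - 5\<close> is exact because
    \<open>g \<ge> 5\<close>.\<close>
  then have "card (single_leaps H) = 4" using assms by simp
  moreover have "odd (2 * g - 5)" using assms(3) by presburger
  ultimately interpret sparse_four_leaps H "2 * g - 5"
    using assms by unfold_locales simp_all
  have "2 * g - 5 + 1 = 2 * g - 4" using assms(3) by simp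
  moreover have "g \<ge> 6" if "7 \<le> 2 * g - 5" using that by simp
  \<comment> \<open>The four cases are distinguished by which of 3, 4, 5 is the first nongap, if
    any.\<close>
  ultimately show ?thesis
    using multiplicity_3 multiplicity_4 multiplicity_5 multiplicity_ge_6 assms(3) by metis
qed

end
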